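(* Let $f:\mathbb{R}\to\mathbb{R}$ be a map and $p$ a fixed point of $f$. The following statements are true. (i) If $f$ is Lipschitz with constant $c<1$ in a neighborhood of $p$, then $p$ is the unique fixed point of $f$ in this neighborhood and it is a sink. (ii) If $f$ is reverse Lipschitz with constant $r>1$ in a neighborhood of $p$, then $p$ is the unique fixed point of $f$ in this neighborhood and it is a source.
   Context: $f$ is Lipschitz with constant $c$ in $N$ if $|f(x)-f(y)|\le c|x-y|$ for all $x,y\in N$; $f$ is reverse Lipschitz with constant $r>0$ in $N$ if $|f(x)-f(y)|\ge r|x-y|$ for all $x,y\in N$. $N_\epsilon(p)=(p-\epsilon,p+\epsilon)$. A fixed point $p$ is a sink if there is $\epsilon>0$ such that $\lim_{k\to\infty}f^k(x)=p$ for all $x\in N_\epsilon(p)$. A fixed point $p$ is a source if there is $\epsilon>0$ such that for every $x\in N_\epsilon(p)$, $x\ne p$, there is a positive integer $k$ with $|f^k(x)-p|\ge\epsilon$. *)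

theory Defs
  imports "HOL-Analysis.Analysis"
begin

text \<open>A neighborhood of p is any set N with p in its interior. The library predicate
  \<open>c-lipschitz_on N f\<close> includes \<open>0 \<le> c\<close>; on a neighborhood of a point of the line this is automatic,
  so it is the bare inequality with an arbitrary real c.\<close>

lemma lipschitz_on_neighborhood_iff:
  fixes f :: "real \<Rightarrow> real"
  assumes "p \<in> interior N"
  shows "c-lipschitz_on N f \<longleftrightarrow> (\<forall>x\<in>N. \<forall>y\<in>N. \<bar>f x - f y\<bar> \<le> c * \<bar>x - y\<bar>)"
proof
  assume "c-lipschitz_on N f"
  then show "\<forall>x\<in>N. \<forall>y\<in>N. \<bar>f x - f y\<bar> \<le> c * \<bar>x - y\<bar>"
    by (auto simp: lipschitz_on_def dist_real_def)
next
  assume L: "\<forall>x\<in>N. \<forall>y\<in>N. \<bar>f x - f y\<bar> \<le> c * \<bar>x - y\<bar>"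
  obtain e where e: "e > 0" "ball p e \<subseteq> N"
    using assms by (auto simp: mem_interior)
  have "p \<in> N" "p + e / 2 \<in> N"
    using e by (auto simp: subset_iff dist_real_def)
  with L have "\<bar>f (p + e / 2) - f p\<bar> \<le> c * \<bar>p + e / 2 - p\<bar>"
    by blast
  then have "0 \<le> c * \<bar>p + e / 2 - p\<bar>"
    using abs_ge_zero order_trans by blast
  then have "0 \<le> c"
    using e(1) by (simp add: zero_le_mult_iff)
  with L show "c-lipschitz_on N f"
    by (auto simp: lipschitz_on_def dist_real_def)
qed

definition reverse_lipschitz_on :: "real \<Rightarrow> real set \<Rightarrow> (real \<Rightarrow> real) \<Rightarrow> bool" where
  "reverse_lipschitz_on r N f \<longleftrightarrow>
    r > 0 \<and> (\<forall>x\<in>N. \<forall>y\<in>N. \<bar>f x - f y\<bar> \<ge> r * \<bar>x - y\<bar>)"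

definition sink :: "(real \<Rightarrow> real) \<Rightarrow> real \<Rightarrow> bool" where
  "sink f p \<longleftrightarrow>
    f p = p \<and> (\<exists>\<epsilon>>0. \<forall>x\<in>{p - \<epsilon><..<p + \<epsilon>}. (\<lambda>k. (f ^^ k) x) \<longlonglongrightarrow> p)"

definition source :: "(real \<Rightarrow> real) \<Rightarrow> real \<Rightarrow> bool" where
  "source f p \<longleftrightarrow>
    f p = p \<and>
    (\<exists>\<epsilon>>0. \<forall>x\<in>{p - \<epsilon><..<p + \<epsilon>}. x \<noteq> p \<longrightarrow> (\<exists>k::nat. k > 0 \<and> \<bar>(f ^^ k) x - p\<bar> \<ge> \<epsilon>))"

end

theory Submission
  imports Defs
begin

text \<open>Two fixed points in \<open>N\<close> keep their distance under \<open>f\<close>, which a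
  factor \<open>c < 1\<close> or \<open>r > 1\<close> allows only at distance zero. For the
  dynamics, iterating the estimate against \<open>p\<close> bounds the distance of the
  \<open>k\<close>-th iterate from \<open>p\<close> above by
  \<open>c ^ k * \<bar>x - p\<bar>\<close>, or below by \<open>r ^ k * \<bar>x - p\<bar>\<close>:
  geometric decay gives a sink (\<open>lipschitz_fixed_point_sink\<close>), geometric growth a
  source (\<open>reverse_lipschitz_fixed_point_source\<close>). The estimate applies only while the
  orbit is in \<open>N\<close>, so both arguments work in a ball around \<open>p\<close> inside
  \<open>N\<close>.\<close>

lemma lipschitz_fixed_point_unique:
  fixes f :: "real \<Rightarrow> real"
  assumes "c-lipschitz_on N f" "c < 1" "x \<in> N" "y \<in> N" "f x = x" "f y = y"
  shows "x = y"
proof (rule ccontr)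
  assume "x \<noteq> y"
  have "dist x y \<le> c * dist x y"
    using lipschitz_onD[OF assms(1,3,4)] assms(5,6) by simp
  with \<open>x \<noteq> y\<close> \<open>c < 1\<close> show False
    by simp
qed

text \<open>Contraction towards \<open>p\<close> traps the orbit in the ball, so one induction gives
  both confinement and the geometric bound.\<close>

lemma lipschitz_fixed_point_sink:
  fixes f :: "real \<Rightarrow> real"
  assumes "f p = p" "p \<in> interior N" "c < 1" and L: "c-lipschitz_on N f"
  shows "sink f p"
proof -
  obtain e where e: "e > 0" "ball p e \<subseteq> N"
    using assms(2) by (auto simp: mem_interior)
  have c0: "0 \<le> c"
    using L by (rule lipschitz_on_nonneg)
  have "(\<lambda>k. (f ^^ k) x) \<longlonglongrightarrow> p" if "x \<in> {p - e<..<p + e}" for x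
  proof -
    have x: "\<bar>x - p\<bar> < e"
      using that by auto
    have bound: "\<bar>(f ^^ k) x - p\<bar> \<le> c ^ k * \<bar>x - p\<bar>" for k
    proof (induction k)
      case (Suc k)
      \<comment> \<open>Since \<open>c ^ k \<le> 1\<close>, the induction hypothesis keeps the
        iterate within \<open>e\<close> of \<open>p\<close>, hence in \<open>N\<close>, where the
        Lipschitz bound applies once more.\<close>
      have "c ^ k * \<bar>x - p\<bar> \<le> 1 * \<bar>x - p\<bar>"
        using c0 \<open>c < 1\<close> by (intro mult_right_mono power_le_one) auto
      then have "\<bar>(f ^^ k) x - p\<bar> < e"
        using Suc x by simp
      then have "(f ^^ k) x \<in> N" "p \<in> N"
        using e by (auto simp: subset_iff dist_real_def abs_minus_commute)
      then have "\<bar>f ((f ^^ k) x) - p\<bar> \<le> c * \<bar>(f ^^ k) x - p\<bar>"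
        using lipschitz_onD[OF L, of "(f ^^ k) x" p] \<open>f p = p\<close> by (simp add: dist_real_def)
      also have "\<dots> \<le> c * (c ^ k * \<bar>x - p\<bar>)"
        using Suc c0 by (rule mult_left_mono)
      finally show ?case
        by (simp add: mult.assoc)
    qed simp
    have "(\<lambda>k. c ^ k * \<bar>x - p\<bar>) \<longlonglongrightarrow> 0"
      using LIMSEQ_power_zero[of c] c0 \<open>c < 1\<close> by (intro tendsto_mult_left_zero) simp
    then have "(\<lambda>k. (f ^^ k) x - p) \<longlonglongrightarrow> 0"
      by (rule Lim_null_comparison[rotated]) (simp add: bound)
    then show ?thesis
      by (rule LIM_zero_cancel)
  qed
  with e(1) \<open>f p = p\<close> show ?thesis
    unfolding sink_def by blast
qed

lemma reverse_lipschitz_fixed_point_unique: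
  assumes "reverse_lipschitz_on r N f" "r > 1" "x \<in> N" "y \<in> N" "f x = x" "f y = y"
  shows "x = y"
proof (rule ccontr)
  assume "x \<noteq> y"
  have "r * \<bar>x - y\<bar> \<le> \<bar>x - y\<bar>"
    using assms unfolding reverse_lipschitz_on_def by metis
  with \<open>x \<noteq> y\<close> \<open>r > 1\<close> show False
    by simp
qed

text \<open>An orbit that never leaves the ball stays in \<open>N\<close>, so its distance from
  \<open>p\<close> would grow geometrically, contradicting the bound \<open>e\<close>.\<close>

lemma reverse_lipschitz_fixed_point_source:
  assumes "f p = p" "p \<in> interior N" "r > 1" and R: "reverse_lipschitz_on r N f"
  shows "source f p"
proof -
  obtain e where e: "e > 0" "ball p e \<subseteq> N"
    using assms(2) by (auto simp: mem_interior)
  have "\<exists>k>0. \<bar>(f ^^ k) x - p\<bar> \<ge> e" if x: "x \<in> {p - e<..<p + e}" "x \<noteq> p" for x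
  proof (rule ccontr)
    assume "\<not> ?thesis"
    then have "k > 0 \<Longrightarrow> \<bar>(f ^^ k) x - p\<bar> < e" for k
      by (meson not_le)
    \<comment> \<open>The negated claim concerns only positive \<open>k\<close>; the starting point
      is in the ball by choice of \<open>x\<close>.\<close>
    moreover have "\<bar>(f ^^ 0) x - p\<bar> < e"
      using x(1) by auto
    ultimately have near: "\<bar>(f ^^ k) x - p\<bar> < e" for k
      by (cases "k = 0") blast+
    have growth: "r ^ k * \<bar>x - p\<bar> \<le> \<bar>(f ^^ k) x - p\<bar>" for k
    proof (induction k)
      case (Suc k)
      have "r ^ Suc k * \<bar>x - p\<bar> \<le> r * \<bar>(f ^^ k) x - p\<bar>"
        using mult_left_mono[OF Suc, of r] \<open>r > 1\<close> by (simp add: mult.assoc)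
      also have "(f ^^ k) x \<in> N" "p \<in> N"
        using e near[of k] by (auto simp: subset_iff dist_real_def abs_minus_commute)
      then have "r * \<bar>(f ^^ k) x - p\<bar> \<le> \<bar>f ((f ^^ k) x) - p\<bar>"
        using R \<open>f p = p\<close> unfolding reverse_lipschitz_on_def by metis
      finally show ?case
        by simp
    qed simp
    \<comment> \<open>The quotient is the growth factor needed to reach distance \<open>e\<close>;
      clearing the denominator uses \<open>x \<noteq> p\<close>.\<close>
    obtain k where "e / \<bar>x - p\<bar> < r ^ k"
      using real_arch_pow[OF \<open>r > 1\<close>] by blast
    then have "e < r ^ k * \<bar>x - p\<bar>"
      using x(2) by (simp add: field_simps)
    with growth[of k] near[of k] show False
      by linarith
  qed
  with e(1) \<open>f p = p\<close> show ?thesis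
    unfolding source_def by blast
qed

theorem theorem5p1:
  fixes f :: "real \<Rightarrow> real" and p :: real
  assumes "f p = p"
  shows "(\<forall>N c. p \<in> interior N \<and> c < 1 \<and> c-lipschitz_on N f \<longrightarrow>
            {x \<in> N. f x = x} = {p} \<and> sink f p) \<and>
         (\<forall>N r. p \<in> interior N \<and> r > 1 \<and> reverse_lipschitz_on r N f \<longrightarrow>
            {x \<in> N. f x = x} = {p} \<and> source f p)"
proof (intro conjI allI impI; elim conjE)
  fix N c assume N: "p \<in> interior N" and "c < 1" "c-lipschitz_on N f"
  \<comment> \<open>Interior points lie in \<open>N\<close>, so \<open>p\<close> belongs to the set;
    uniqueness excludes all others.\<close>
  then show "{x \<in> N. f x = x} = {p}"
    using assms interior_subset[of N] lipschitz_fixed_point_unique[of c N f _ p] by blast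
  show "sink f p"
    by (rule lipschitz_fixed_point_sink) fact+
next
  fix N r assume N: "p \<in> interior N" and "r > 1" "reverse_lipschitz_on r N f"
  then show "{x \<in> N. f x = x} = {p}"
    using assms interior_subset[of N] reverse_lipschitz_fixed_point_unique[of r N f _ p] by blast
  show "source f p"
    by (rule reverse_lipschitz_fixed_point_source) fact+
qed

end
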